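(* Let $(f_n)_{n\ge 1}$ be a sequence of functions in $\mathcal{O}_+(D(0,1))$, $f_n(z)=\sum_{k\ge0} a_{k,n}z^k$, such that the infinite product $\prod_{n\ge1} f_n$ converges uniformly on every compact subset of $D(0,1)$. Then $f=\prod_{n\ge1}f_n$ is analytic in $D(0,1)$ and $f(z)=\sum_{n\ge0}a_n z^n$ with $$a_n=\sum_{n_1+\cdots+n_p=n} a_{n_1,1}\cdots a_{n_p,p}.$$ For each $t\in\,]0,1[$ let $(X_{n,t})_{n\ge1}$ be independent random variables such that $X_{n,t}$ has law $\mu_t(f_n)$. Assume that for every $t\in\,]0,1[$ the series $\sum_{n\ge1}E(X_{n,t})$ and $\sum_{n\ge1}\mathrm{Var}(X_{n,t})$ converge, and set $m(t)=\sum_{n\ge1}E(X_{n,t})$, $\sigma(t)=\big(\sum_{n\ge1}\mathrm{Var}(X_{n,t})\big)^{1/2}$, $X_t=\sum_{n\ge1}X_{n,t}$ and $$Z_t=\frac{X_t-m(t)}{\sigma(t)},$$ with characteristic function $\varphi_{Z_t}(x)=E(e^{ixZ_t})$. Suppose that $Z_t$ converges in law, as $t\to1$, to a random variable of law $N(0,1)$, with the strong convergence condition $$\lim_{t\to1}\int_{-\sigma(t)\pi}^{\sigma(t)\pi}\left|\varphi_{Z_t}(x)-e^{-x^2/2}\right|dx=0.$$ Let $m_1$ and $\sigma_1$ be functions with $m(t)\sim m_1(t)$ and $\sigma(t)\sim\sigma_1(t)$ as $t\to1$. Let $(\tau_n)$ be a sequence in $]0,1[$ converging to $1$ such that $m_1(\tau_n)=n$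 for all $n$, and such that $$\frac{m(\tau_n)-m_1(\tau_n)}{\sigma_1(\tau_n)}\to0\quad\text{as } \tau_n\to1.$$ Then, as $n\to\infty$, $$a_n\sim\frac{f(\tau_n)}{\sqrt{2\pi}\,\sigma_1(\tau_n)\,\tau_n^{\,n}}.$$
   Context: $D(0,1)$ is the open unit disk in $\mathbb{C}$. $\mathcal{O}_+(D(0,1))$ denotes the set of functions $f$ analytic with radius of convergence $1$ such that $f(z) = \sum_{n\ge 0} a_n z^n$ with all $a_n$ real and nonnegative and not all zero. For such $f$ and $t \in\, ]0,1[$, $\mu_t(f)$ is the discrete probability measure $\mu_t(f) = \sum_{n \ge 0} \frac{a_n t^n}{f(t)} \delta_n$ on $\mathbb{R}$, $\delta_n$ being the Dirac mass at $n$. Under the stated convergence of the series of means and variances, the series $\sum_{n\ge1}X_{n,t}$ of nonnegative independent variables converges almost surely, its sum $X_t$ has law $\mu_t(f)$, $E(X_t)=m(t)$ and $\mathrm{Var}(X_t)=\sigma(t)^2$. The notation $u\sim v$ means $u/v\to1$. *)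

theory Defs
  imports "HOL-Complex_Analysis.Complex_Analysis" "HOL-Probability.Probability"
begin

text \<open>
  All sequences indexed by the integers \<open>n \<ge> 1\<close> are functions on \<open>nat\<close> whose value at \<open>0\<close> is
  irrelevant; infinite sums and products over them are written with \<open>Suc n\<close>.
\<close>

definition O_plus :: "(complex \<Rightarrow> complex) set" where
  "O_plus = {f. \<exists>a :: nat \<Rightarrow> real.
     (\<forall>n. 0 \<le> a n) \<and> (\<exists>n. a n \<noteq> 0) \<and> conv_radius a = 1 \<and>
     (\<forall>z\<in>ball 0 1. (\<lambda>n. of_real (a n) * z ^ n) sums f z)}"

text \<open>
  The measure \<open>\<mu>\<^sub>t(f) = (\<Sum>n. a\<^sub>n t\<^sup>n / f(t) \<delta>\<^sub>n)\<close> on the reals, where \<open>a\<^sub>n\<close> is the \<open>n\<close>-th Taylor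
  coefficient of \<open>f\<close> at \<open>0\<close>; see \<open>emeasure_mu\<close> and \<open>taylor_coeff_eq\<close> below.
\<close>

definition taylor_coeff :: "(complex \<Rightarrow> complex) \<Rightarrow> nat \<Rightarrow> real" where
  "taylor_coeff f n = Re (fps_nth (fps_expansion f 0) n)"

definition mu :: "real \<Rightarrow> (complex \<Rightarrow> complex) \<Rightarrow> real measure" where
  "mu t f = distr
     (point_measure UNIV (\<lambda>n. ennreal (taylor_coeff f n * t ^ n / Re (f (of_real t)))))
     borel (\<lambda>n::nat. real n)"

lemma taylor_coeff_eq:
  assumes "\<And>z. z \<in> ball 0 1 \<Longrightarrow> (\<lambda>n. of_real (a n) * z ^ n) sums f z"
  shows "taylor_coeff f n = a n"
proof -
  define F where "F = Abs_fps (\<lambda>n. complex_of_real (a n))"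
  have "conv_radius (\<lambda>n. complex_of_real (a n)) \<ge> 1"
  proof (rule conv_radius_geI_ex')
    fix r :: real assume "0 < r" "ereal r < 1"
    then show "summable (\<lambda>n. complex_of_real (a n) * of_real r ^ n)"
      using assms[of "of_real r"] by (auto simp: sums_iff)
  qed
  then have "fps_conv_radius F > 0"
    using less_le_trans[of 0 "1 :: ereal"] by (simp add: F_def fps_conv_radius_def)
  moreover have "eventually (\<lambda>z. eval_fps F z = f z) (nhds 0)"
  proof (rule eventually_nhds_in_open[of "ball 0 1" 0, THEN eventually_mono])
    fix z :: complex assume "z \<in> ball 0 1"
    from assms[OF this] show "eval_fps F z = f z"
      by (simp add: eval_fps_def F_def sums_iff)
  qed auto
  ultimately have "f has_fps_expansion F"
    by (simp add: has_fps_expansion_def)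
  then have "fps_expansion f 0 = F"
    by (rule fps_expansion_eqI)
  then show ?thesis
    by (simp add: taylor_coeff_def F_def)
qed

lemma emeasure_mu:
  assumes "A \<in> sets borel"
  shows "emeasure (mu t f) A =
    (\<Sum>n. ennreal (taylor_coeff f n * t ^ n / Re (f (of_real t))) * emeasure (return borel (real n)) A)"
  using assms
  by (simp add: mu_def emeasure_distr point_measure_def emeasure_density
        nn_integral_count_space_nat indicator_def vimage_def)

text \<open>
  Compact convergence of \<open>\<Prod>n\<ge>1. f n\<close> on \<open>D\<close>. As usual for infinite products, convergence at a
  point means that the partial products from some index on have a nonzero limit
  (\<open>convergent_prod\<close>), so the product does not diverge to \<open>0\<close>.
\<close>

definition compactly_convergent_prod :: "(nat \<Rightarrow> complex \<Rightarrow> complex) \<Rightarrow> complex set \<Rightarrow> bool" where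
  "compactly_convergent_prod f D \<longleftrightarrow>
     (\<forall>z\<in>D. convergent_prod (\<lambda>n. f (Suc n) z)) \<and>
     (\<forall>K. compact K \<and> K \<subseteq> D \<longrightarrow> uniformly_convergent_on K (\<lambda>N z. \<Prod>n=1..N. f n z))"

definition inf_prod :: "(nat \<Rightarrow> complex \<Rightarrow> complex) \<Rightarrow> complex \<Rightarrow> complex" where
  "inf_prod f z = (\<Prod>n. f (Suc n) z)"

text \<open>
  The sum over \<open>n\<^sub>1 + \<dots> + n\<^sub>p = n\<close> of \<open>a\<^bsub>n\<^sub>1,1\<^esub> \<dots> a\<^bsub>n\<^sub>p,p\<^esub>\<close> ranges over all families
  \<open>(n\<^sub>j)\<^bsub>j\<ge>1\<^esub>\<close> of natural numbers with sum \<open>n\<close>; each is eventually zero. Its term is the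
  infinite product of all \<open>a\<^bsub>n\<^sub>j,j\<^esub>\<close>, which is the finite product written above when
  \<open>a\<^bsub>0,j\<^esub> = 1\<close> for \<open>j > p\<close>; in general the constant coefficients \<open>a\<^bsub>0,j\<^esub>\<close> also contribute.
\<close>

definition families_with_sum :: "nat \<Rightarrow> (nat \<Rightarrow> nat) set" where
  "families_with_sum n = {\<nu>. \<nu> 0 = 0 \<and> finite {j. \<nu> j \<noteq> 0} \<and> (\<Sum>j | \<nu> j \<noteq> 0. \<nu> j) = n}"

definition family_term :: "(nat \<Rightarrow> nat \<Rightarrow> real) \<Rightarrow> (nat \<Rightarrow> nat) \<Rightarrow> real" where
  "family_term a \<nu> = (\<Prod>j. a (\<nu> (Suc j)) (Suc j))"

definition prod_coeff :: "(nat \<Rightarrow> nat \<Rightarrow> real) \<Rightarrow> nat \<Rightarrow> real" where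
  "prod_coeff a n = (\<Sum>\<^sub>\<infinity>\<nu>\<in>families_with_sum n. family_term a \<nu>)"

text \<open>
  \<open>X t n\<close> is the random variable \<open>X\<^bsub>n,t\<^esub>\<close>, defined on the probability space \<open>M t\<close>.
\<close>

definition mean_term :: "(real \<Rightarrow> 'w measure) \<Rightarrow> (real \<Rightarrow> nat \<Rightarrow> 'w \<Rightarrow> real) \<Rightarrow> real \<Rightarrow> nat \<Rightarrow> real" where
  "mean_term M X t n = (\<integral>\<omega>. X t n \<omega> \<partial>M t)"

definition var_term :: "(real \<Rightarrow> 'w measure) \<Rightarrow> (real \<Rightarrow> nat \<Rightarrow> 'w \<Rightarrow> real) \<Rightarrow> real \<Rightarrow> nat \<Rightarrow> real" where
  "var_term M X t n = (\<integral>\<omega>. (X t n \<omega> - mean_term M X t n)\<^sup>2 \<partial>M t)"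

definition total_mean :: "(real \<Rightarrow> 'w measure) \<Rightarrow> (real \<Rightarrow> nat \<Rightarrow> 'w \<Rightarrow> real) \<Rightarrow> real \<Rightarrow> real" where
  "total_mean M X t = (\<Sum>n. mean_term M X t (Suc n))"

definition total_sd :: "(real \<Rightarrow> 'w measure) \<Rightarrow> (real \<Rightarrow> nat \<Rightarrow> 'w \<Rightarrow> real) \<Rightarrow> real \<Rightarrow> real" where
  "total_sd M X t = sqrt (\<Sum>n. var_term M X t (Suc n))"

definition total :: "(real \<Rightarrow> nat \<Rightarrow> 'w \<Rightarrow> real) \<Rightarrow> real \<Rightarrow> 'w \<Rightarrow> real" where
  "total X t \<omega> = (\<Sum>n. X t (Suc n) \<omega>)"

definition Z_var :: "(real \<Rightarrow> 'w measure) \<Rightarrow> (real \<Rightarrow> nat \<Rightarrow> 'w \<Rightarrow> real) \<Rightarrow> real \<Rightarrow> 'w \<Rightarrow> real" where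
  "Z_var M X t \<omega> = (total X t \<omega> - total_mean M X t) / total_sd M X t"

definition Z_law :: "(real \<Rightarrow> 'w measure) \<Rightarrow> (real \<Rightarrow> nat \<Rightarrow> 'w \<Rightarrow> real) \<Rightarrow> real \<Rightarrow> real measure" where
  "Z_law M X t = distr (M t) borel (Z_var M X t)"

text \<open>\<open>weak_conv_m\<close>, with an arbitrary filter in place of \<open>sequentially\<close>.\<close>

definition weak_conv_filter :: "('i \<Rightarrow> real measure) \<Rightarrow> real measure \<Rightarrow> 'i filter \<Rightarrow> bool" where
  "weak_conv_filter L N F \<longleftrightarrow>
     (\<forall>x. isCont (cdf N) x \<longrightarrow> ((\<lambda>i. cdf (L i) x) \<longlongrightarrow> cdf N x) F)"

end

theory Submission
  imports Defs
begin

text \<open>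
  The coefficients of the partial products converge to those of the product by uniform convergence;
  since all terms are nonnegative and the tails of the product of the constant coefficients tend
  to 1, this identifies the coefficients of the product as unordered sums over families.

  For the asymptotics, the characteristic function of the sum at \<open>x\<close> is
  \<open>f (t exp (ix)) / f t\<close>, so Fourier inversion on a period writes \<open>2 \<pi> \<sigma>(t) a\<^sub>n t\<^sup>n / f(t)\<close> as the integral of
  \<open>\<phi>(x) exp (ix (m(t) - n) / \<sigma>(t))\<close> over \<open>[-\<pi> \<sigma>(t), \<pi> \<sigma>(t)]\<close>, where \<open>\<phi>\<close> belongs to the normalized sum.
  By strong convergence \<open>\<phi>\<close> may be replaced by the Gaussian, and for \<open>t = \<tau>\<^sub>n\<close> the exponential factor
  tends to 1. That \<open>\<sigma>(t)\<close> tends to infinity is forced by the convergence of a lattice-valued variable to a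
  law with a positive density.
\<close>

section \<open>Coefficients of the infinite product\<close>

text \<open>Finitely many multisets involve only finitely many indices, so a large enough
  \<open>N\<close> bounds them all. The sets \<open>multisets_of_size {1..N} n\<close> are those
  indexing the coefficients of the partial products, and this makes them an exhaustion suited to
  unordered sums.\<close>

lemma multisets_of_size_tendsto_finite_subsets:
  "filterlim (\<lambda>N. multisets_of_size {1..N} n)
     (finite_subsets_at_top {X :: nat multiset. size X = n \<and> 0 \<notin># X}) sequentially"
  unfolding filterlim_finite_subsets_at_top
proof (intro allI impI)
  fix F :: "nat multiset set"
  assume F: "finite F \<and> F \<subseteq> {X. size X = n \<and> 0 \<notin># X}"
  define K where "K = Max (insert 0 (\<Union>X\<in>F. set_mset X))"
  have K: "i \<le> K" if "X \<in> F" "i \<in># X" for X i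
    unfolding K_def using F that by (intro Max_ge) auto
  show "\<forall>\<^sub>F N in sequentially. finite (multisets_of_size {1..N} n) \<and>
      F \<subseteq> multisets_of_size {1..N} n \<and>
      multisets_of_size {1..N} n \<subseteq> {X. size X = n \<and> 0 \<notin># X}"
    using eventually_ge_at_top[of K]
  proof eventually_elim
    case (elim N)
    have "set_mset X \<subseteq> {1..N}" if "X \<in> F" for X
    proof
      fix i assume i: "i \<in># X"
      then have "i \<noteq> 0" using F that by (metis (mono_tags, lifting) mem_Collect_eq subsetD)
      then show "i \<in> {1..N}" using K[OF that i] elim by simp
    qed
    then show ?case
      using F by (fastforce simp: multisets_of_size_def intro: finite_multisets_of_size)
  qed
qed

text \<open>With nonnegative terms every finite partial sum is eventually dominated by the sum over
  \<open>B N\<close>, hence bounded by \<open>c\<close>. So the unordered sum exists, and its value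
  can be read off along the single exhaustion \<open>B\<close>.\<close>

lemma has_sum_nonneg_exhaustion:
  fixes g :: "'a \<Rightarrow> real"
  assumes B: "filterlim B (finite_subsets_at_top A) sequentially"
    and nonneg: "\<And>x. x \<in> A \<Longrightarrow> 0 \<le> g x"
    and lim: "(\<lambda>N. sum g (B N)) \<longlonglongrightarrow> c"
  shows "(g has_sum c) A"
proof -
  have "sum g F \<le> c" if F: "finite F" "F \<subseteq> A" for F
  proof (rule tendsto_lowerbound[OF lim])
    have "\<forall>\<^sub>F N in sequentially. finite (B N) \<and> F \<subseteq> B N \<and> B N \<subseteq> A"
      using B F unfolding filterlim_finite_subsets_at_top by blast
    then show "\<forall>\<^sub>F N in sequentially. sum g F \<le> sum g (B N)"
      by eventually_elim (use nonneg in \<open>auto intro!: sum_mono2\<close>)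
  qed simp
  then have "g summable_on A"
    by (intro nonneg_bdd_above_summable_on nonneg) (auto simp: bdd_above_def)
  then have *: "(g has_sum infsum g A) A"
    by simp
  have "(\<lambda>N. sum g (B N)) \<longlonglongrightarrow> infsum g A"
    using filterlim_compose[OF *[unfolded has_sum_def] B] .
  with lim have "infsum g A = c"
    by (rule LIMSEQ_unique[symmetric])
  with * show ?thesis by simp
qed

text \<open>Past the finitely many zero factors, a tail is the whole product divided by an initial
  product, and the latter tends to the same nonzero value.\<close>

lemma convergent_prod_tail_tendsto_1:
  fixes b :: "nat \<Rightarrow> real"
  assumes b: "convergent_prod b"
  shows "(\<lambda>N. \<Prod>k. b (k + N)) \<longlonglongrightarrow> 1"
proof -
  obtain J where J: "\<And>k. k \<ge> J \<Longrightarrow> b k \<noteq> 0"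
    using convergent_prod_imp_ev_nonzero[OF b] by (auto simp: eventually_at_top_linorder)
  define c where "c = (\<lambda>k. b (k + J))"
  have c: "convergent_prod c" "\<And>k. c k \<noteq> 0"
    using b J by (auto simp: c_def)
  have "(\<lambda>n. \<Prod>i<n. c i) \<longlonglongrightarrow> prodinf c"
    using convergent_prod_LIMSEQ[OF c(1)] by (simp add: LIMSEQ_lessThan_iff_atMost)
  then have "(\<lambda>n. prodinf c / (\<Prod>i<n. c i)) \<longlonglongrightarrow> prodinf c / prodinf c"
    using prodinf_nonzero[OF c] by (intro tendsto_divide) auto
  then have "(\<lambda>n. \<Prod>k. c (k + n)) \<longlonglongrightarrow> 1"
    using prodinf_nonzero[OF c] by (simp add: prodinf_divide_initial_segment[OF c])
  then have "(\<lambda>n. \<Prod>k. b (k + (n + J))) \<longlonglongrightarrow> 1"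
    by (simp add: c_def add.assoc)
  then show ?thesis by (rule LIMSEQ_offset)
qed

lemma inj_count: "inj count"
  by (auto intro: injI simp: multiset_eqI)

text \<open>A family is the multiplicity function of a multiset: the entry at \<open>j\<close>
  counts the copies of \<open>j\<close>, and the sum of the entries is the size. This matches the
  index set with the one in the formula \<open>fps_prod_nth'\<close> for coefficients of a finite
  product of power series.\<close>

lemma families_with_sum_eq_image:
  "families_with_sum n = count ` {X. size X = n \<and> 0 \<notin># X}"
proof (intro equalityI subsetI)
  fix \<nu> :: "nat \<Rightarrow> nat" assume \<nu>: "\<nu> \<in> families_with_sum n"
  then have fin: "finite {j. 0 < \<nu> j}"
    by (simp add: families_with_sum_def)
  define X where "X = Abs_multiset \<nu>"
  have c: "count X = \<nu>" using fin by (simp add: X_def)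
  have s: "set_mset X = {j. \<nu> j \<noteq> 0}" using c by (auto simp: set_mset_def)
  have "size X = n"
    using \<nu> by (simp add: size_multiset_overloaded_eq s c families_with_sum_def)
  moreover have "0 \<notin># X" using \<nu> s by (auto simp: families_with_sum_def)
  ultimately show "\<nu> \<in> count ` {X. size X = n \<and> 0 \<notin># X}"
    using c by (intro image_eqI[of _ _ X]) auto
next
  fix \<nu> :: "nat \<Rightarrow> nat" assume "\<nu> \<in> count ` {X. size X = n \<and> 0 \<notin># X}"
  then obtain X where X: "\<nu> = count X" "size X = n" "0 \<notin># X" by auto
  have s: "{j. \<nu> j \<noteq> 0} = set_mset X" using X by auto
  show "\<nu> \<in> families_with_sum n"
    unfolding families_with_sum_def s mem_Collect_eq using X
    by (auto simp: size_multiset_overloaded_eq not_in_iff)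
qed

section \<open>Power series and compactly convergent products on the unit disc\<close>

lemma power_series_has_fps_expansion:
  fixes f :: "complex \<Rightarrow> complex"
  assumes "\<And>z. z \<in> ball 0 1 \<Longrightarrow> (\<lambda>k. c k * z ^ k) sums f z"
  shows "f has_fps_expansion Abs_fps c"
proof -
  have "conv_radius c \<ge> 1"
  proof (rule conv_radius_geI_ex')
    fix r :: real assume "0 < r" "ereal r < 1"
    then show "summable (\<lambda>n. c n * of_real r ^ n)"
      using assms[of "of_real r"] by (auto simp: sums_iff)
  qed
  then have "fps_conv_radius (Abs_fps c) > 0"
    using less_le_trans[of 0 "1 :: ereal"] by (simp add: fps_conv_radius_def)
  moreover have "\<forall>\<^sub>F z in nhds 0. eval_fps (Abs_fps c) z = f z"
    using eventually_nhds_in_open[of "ball 0 1" 0]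
    by (rule eventually_mono[rotated 2]) (use assms in \<open>auto simp: eval_fps_def sums_iff\<close>)
  ultimately show ?thesis by (simp add: has_fps_expansion_def)
qed

lemma unit_disc_power_series_holomorphic:
  fixes f :: "complex \<Rightarrow> complex"
  assumes "\<And>z. z \<in> ball 0 1 \<Longrightarrow> (\<lambda>k. c k * z ^ k) sums f z"
  shows "f holomorphic_on ball 0 1"
  using assms by (intro power_series_holomorphic[of 0 1 c]) auto

locale nonneg_prod =
  fixes f :: "nat \<Rightarrow> complex \<Rightarrow> complex" and a :: "nat \<Rightarrow> nat \<Rightarrow> real"
  assumes O_plus: "n \<ge> 1 \<Longrightarrow> f n \<in> O_plus"
    and sums_f: "n \<ge> 1 \<Longrightarrow> z \<in> ball 0 1 \<Longrightarrow> (\<lambda>k. of_real (a k n) * z ^ k) sums f n z"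
    and conv: "compactly_convergent_prod f (ball 0 1)"
begin

lemma taylor_coeff: "n \<ge> 1 \<Longrightarrow> taylor_coeff (f n) k = a k n"
  using taylor_coeff_eq[OF sums_f] by blast

text \<open>Membership in \<open>O_plus\<close> only provides some nonnegative coefficient sequence;
  uniqueness of Taylor coefficients identifies it with that of \<open>f n\<close>.\<close>

lemma coeff_props:
  assumes "n \<ge> 1"
  shows coeff_nonneg: "0 \<le> a k n" and coeff_nontrivial: "\<exists>k. a k n \<noteq> 0"
proof -
  obtain b where b: "\<forall>n. 0 \<le> b n" "\<exists>n. b n \<noteq> (0::real)"
     "\<And>z. z\<in>ball 0 1 \<Longrightarrow> (\<lambda>k. of_real (b k) * z ^ k) sums f n z"
    using O_plus[OF assms] unfolding O_plus_def by blast
  have "b k = a k n" for k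
    using taylor_coeff_eq[OF b(3)] taylor_coeff[OF assms] by metis
  then show "0 \<le> a k n" "\<exists>k. a k n \<noteq> 0" using b by metis+
qed

lemma convergent_prod_f: "z \<in> ball 0 1 \<Longrightarrow> convergent_prod (\<lambda>n. f (Suc n) z)"
  using conv by (auto simp: compactly_convergent_prod_def)

lemma partial_prods_tendsto:
  assumes "z \<in> ball 0 1"
  shows "(\<lambda>N. \<Prod>n=1..N. f n z) \<longlonglongrightarrow> inf_prod f z"
proof -
  have "(\<lambda>n. \<Prod>i<n. f (Suc i) z) \<longlonglongrightarrow> inf_prod f z"
    using convergent_prod_LIMSEQ[OF convergent_prod_f[OF assms]]
    by (simp add: LIMSEQ_lessThan_iff_atMost inf_prod_def)
  then show ?thesis
    by (simp add: prod.atLeast1_atMost_eq lessThan_atLeast0)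
qed

text \<open>The hypothesis provides some uniform limit on \<open>K\<close>; pointwise convergence of
  the product identifies it as \<open>inf_prod f\<close>.\<close>

lemma uniform_limit_partial_prods:
  assumes "compact K" "K \<subseteq> ball 0 1"
  shows "uniform_limit K (\<lambda>N z. \<Prod>n=1..N. f n z) (inf_prod f) sequentially"
proof -
  obtain l where l: "uniform_limit K (\<lambda>N z. \<Prod>n=1..N. f n z) l sequentially"
    using conv assms by (auto simp: compactly_convergent_prod_def uniformly_convergent_on_def)
  have "l z = inf_prod f z" if "z \<in> K" for z
    using tendsto_uniform_limitI[OF l that] partial_prods_tendsto[of z] that assms
    by (intro LIMSEQ_unique) auto
  then show ?thesis
    using l by (subst uniform_limit_cong'[where g = "\<lambda>N z. \<Prod>n=1..N. f n z" and i = l]) auto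
qed

lemma partial_prods_holomorphic: "(\<lambda>z. \<Prod>n=1..N. f n z) holomorphic_on ball 0 1"
  using unit_disc_power_series_holomorphic[OF sums_f] by (intro holomorphic_intros) auto

lemma inf_prod_holomorphic: "inf_prod f holomorphic_on ball 0 1"
proof (rule holomorphic_uniform_sequence[OF open_ball partial_prods_holomorphic])
  fix x :: complex assume x: "x \<in> ball 0 1"
  then obtain d where "0 < d" "cball x d \<subseteq> ball 0 1"
    using open_contains_cball[of "ball (0::complex) 1"] open_ball by blast
  then show "\<exists>d>0. cball x d \<subseteq> ball 0 1 \<and>
      uniform_limit (cball x d) (\<lambda>N z. \<Prod>n=1..N. f n z) (inf_prod f) sequentially"
    using uniform_limit_partial_prods[of "cball x d"] by auto
qed

text \<open>This is the \<open>n\<close>-th coefficient of the product of the first \<open>N\<close>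
  factors: a multiset \<open>X\<close> selects from factor \<open>j\<close> the monomial of degree
  \<open>count X j\<close>.\<close>

definition partial_coeff :: "nat \<Rightarrow> nat \<Rightarrow> real" where
  "partial_coeff N n = (\<Sum>X\<in>multisets_of_size {1..N} n. \<Prod>j=1..N. a (count X j) j)"

lemma deriv_partial_prods:
  "(deriv ^^ n) (\<lambda>z. \<Prod>j=1..N. f j z) 0 / fact n = of_real (partial_coeff N n)"
proof -
  define A where "A = (\<lambda>j. Abs_fps (\<lambda>k. complex_of_real (a k j)))"
  have "(\<lambda>z. \<Prod>j=1..N. f j z) has_fps_expansion (\<Prod>j=1..N. A j)"
    unfolding A_def
    by (intro has_fps_expansion_prod power_series_has_fps_expansion sums_f) auto
  from fps_nth_fps_expansion[OF this, of n]
  have "(deriv ^^ n) (\<lambda>z. \<Prod>j=1..N. f j z) 0 / fact n = fps_nth (\<Prod>j=1..N. A j) n" by simp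
  also have "\<dots> = of_real (partial_coeff N n)"
    by (simp add: fps_prod_nth' A_def partial_coeff_def)
  finally show ?thesis .
qed

text \<open>Uniform convergence of holomorphic functions near 0 carries over to the derivatives of
  every order at 0.\<close>

lemma partial_coeff_tendsto:
  "(\<lambda>N. of_real (partial_coeff N n)) \<longlonglongrightarrow> (deriv ^^ n) (inf_prod f) 0 / fact n"
proof -
  have "uniform_limit (ball 0 (1/2)) (\<lambda>N z. \<Prod>n=1..N. f n z) (inf_prod f) sequentially"
    by (rule uniform_limit_on_subset[OF uniform_limit_partial_prods[of "cball 0 (1/2)"]]) auto
  moreover have "\<forall>\<^sub>F N in sequentially. (\<lambda>z. \<Prod>n=1..N. f n z) holomorphic_on ball 0 (1/2)"
    by (intro always_eventually allI holomorphic_on_subset[OF partial_prods_holomorphic]) auto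
  ultimately have "(\<lambda>N. (deriv ^^ n) (\<lambda>z. \<Prod>n=1..N. f n z) 0) \<longlonglongrightarrow> (deriv ^^ n) (inf_prod f) 0"
    by (rule higher_deriv_complex_uniform_limit) auto
  then have "(\<lambda>N. (deriv ^^ n) (\<lambda>z. \<Prod>n=1..N. f n z) 0 / fact n)
      \<longlonglongrightarrow> (deriv ^^ n) (inf_prod f) 0 / fact n"
    by (intro tendsto_divide) auto
  then show ?thesis by (simp only: deriv_partial_prods)
qed

text \<open>The constant coefficients are the values of the factors at 0, where the product
  converges.\<close>

lemma convergent_prod_const_coeffs: "convergent_prod (\<lambda>k. a 0 (Suc k))"
proof -
  have "f (Suc k) 0 = of_real (a 0 (Suc k))" for k
    using sums_f[of "Suc k" 0] by (auto simp: sums_iff powser_zero)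
  then have "convergent_prod (complex_of_real \<circ> (\<lambda>k. a 0 (Suc k)))"
    using convergent_prod_f[of 0] by (simp add: o_def)
  then show ?thesis by (simp only: convergent_prod_of_real_iff)
qed

text \<open>A multiset supported in \<open>{1..N}\<close> has multiplicity 0 at every larger index,
  so beyond \<open>N\<close> only constant coefficients remain. The resulting tail factor does not
  depend on \<open>X\<close>, which lets it be pulled out of the sum over all
  \<open>X\<close>.\<close>

lemma family_term_props:
  assumes "X \<in> multisets_of_size {1..N} n"
  shows family_term_split:
      "family_term a (count X) = (\<Prod>j=1..N. a (count X j) j) * (\<Prod>k. a 0 (Suc (k + N)))"
    and family_term_nonneg_aux: "0 \<le> family_term a (count X)"
proof -
  define g where "g = (\<lambda>j. a (count X (Suc j)) (Suc j))"
  have tail: "g (k + N) = a 0 (Suc (k + N))" for k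
  proof -
    have "Suc (k + N) \<notin># X" using assms by (fastforce simp: multisets_of_size_def)
    then show ?thesis by (simp add: g_def not_in_iff)
  qed
  have "convergent_prod (\<lambda>k. g (k + N))"
    using convergent_prod_const_coeffs convergent_prod_iff_shift[of "\<lambda>k. a 0 (Suc k)" N]
    by (simp add: tail)
  then have g: "convergent_prod g" by simp
  have "prodinf g = (\<Prod>k<N. g k) * (\<Prod>k. g (k + N))"
    using has_prod_ignore_initial_segment'[OF g] by (simp add: has_prod_iff)
  then show "family_term a (count X) = (\<Prod>j=1..N. a (count X j) j) * (\<Prod>k. a 0 (Suc (k + N)))"
    by (simp add: family_term_def g_def[symmetric] tail prod.atLeast1_atMost_eq lessThan_atLeast0)
       (simp add: g_def)
  have "0 \<le> prodinf g"
    by (rule has_prod_nonneg[OF convergent_prod_has_prod[OF g]]) (simp add: g_def coeff_nonneg)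
  then show "0 \<le> family_term a (count X)"
    by (simp add: family_term_def g_def)
qed

lemma family_term_nonneg:
  assumes "0 \<notin># X"
  shows "0 \<le> family_term a (count X)"
proof (rule family_term_nonneg_aux)
  \<comment> \<open>The largest element of \<open>X\<close> serves as \<open>N\<close>; inserting 0
    keeps \<open>Max\<close> meaningful for the empty multiset.\<close>
  show "X \<in> multisets_of_size {1..Max (insert 0 (set_mset X))} (size X)"
    using assms by (auto simp: multisets_of_size_def Suc_le_eq intro!: gr0I)
qed

text \<open>The sum over multisets supported in \<open>{1..N}\<close> is the coefficient of the
  partial product times a tail of constant coefficients. The first factor tends to the Taylor
  coefficient of the product and the second to 1.\<close>

lemma family_term_has_sum:
  "(family_term a has_sum Re ((deriv ^^ n) (inf_prod f) 0 / fact n)) (families_with_sum n)"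
proof -
  let ?c = "Re ((deriv ^^ n) (inf_prod f) 0 / fact n)"
  have "((\<lambda>X. family_term a (count X)) has_sum ?c) {X. size X = n \<and> 0 \<notin># X}"
  proof (rule has_sum_nonneg_exhaustion[OF multisets_of_size_tendsto_finite_subsets])
    show "0 \<le> family_term a (count X)" if "X \<in> {X. size X = n \<and> 0 \<notin># X}" for X
      using that by (simp add: family_term_nonneg)
  next
    have "(\<lambda>N. partial_coeff N n) \<longlonglongrightarrow> ?c"
      using tendsto_Re[OF partial_coeff_tendsto[of n]] by simp
    moreover have "(\<lambda>N. \<Prod>k. a 0 (Suc (k + N))) \<longlonglongrightarrow> 1"
      using convergent_prod_tail_tendsto_1[OF convergent_prod_const_coeffs] .
    ultimately have "(\<lambda>N. partial_coeff N n * (\<Prod>k. a 0 (Suc (k + N)))) \<longlonglongrightarrow> ?c * 1"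
      by (rule tendsto_mult)
    moreover have "(\<Sum>X\<in>multisets_of_size {1..N} n. family_term a (count X)) =
        partial_coeff N n * (\<Prod>k. a 0 (Suc (k + N)))" for N
      by (simp add: family_term_split partial_coeff_def sum_distrib_right)
    ultimately show "(\<lambda>N. \<Sum>X\<in>multisets_of_size {1..N} n. family_term a (count X)) \<longlonglongrightarrow> ?c"
      by simp
  qed
  then show ?thesis
    unfolding families_with_sum_eq_image
    by (subst has_sum_reindex) (auto simp: o_def intro: inj_on_subset[OF inj_count])
qed

text \<open>The sum over families gives the real part; the imaginary part vanishes because the
  Taylor coefficient is a limit of real numbers.\<close>

lemma prod_coeff_eq: "of_real (prod_coeff a n) = (deriv ^^ n) (inf_prod f) 0 / fact n"
proof -
  let ?d = "(deriv ^^ n) (inf_prod f) 0 / fact n"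
  have "(\<lambda>N. Im (of_real (partial_coeff N n))) \<longlonglongrightarrow> Im ?d"
    by (rule tendsto_Im[OF partial_coeff_tendsto])
  then have "Im ?d = 0" by (simp add: LIMSEQ_const_iff)
  moreover have "prod_coeff a n = Re ?d"
    unfolding prod_coeff_def using family_term_has_sum[of n] by (rule infsumI)
  ultimately show ?thesis by (simp add: complex_eq_iff)
qed

lemma sums_inf_prod:
  assumes "z \<in> ball 0 1"
  shows "(\<lambda>n. of_real (prod_coeff a n) * z ^ n) sums inf_prod f z"
  using holomorphic_power_series[OF inf_prod_holomorphic assms]
  by (simp only: prod_coeff_eq diff_0_right)

lemma prod_coeff_nonneg: "0 \<le> prod_coeff a n"
  unfolding prod_coeff_def families_with_sum_eq_image
  by (intro infsum_nonneg) (auto simp: family_term_nonneg)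

end

section \<open>Convergence and characteristic function of the sum\<close>

lemma nonneg_power_series_real:
  fixes g :: complex
  assumes "(\<lambda>k. of_real (c k) * of_real t ^ k) sums g" "\<And>k. 0 \<le> c k" "0 \<le> (t::real)"
  shows "(\<lambda>k. c k * t ^ k) sums Re g" and "of_real (Re g) = g" and "0 \<le> Re g"
proof -
  have 1: "(\<lambda>k. complex_of_real (c k * t ^ k)) sums g"
    using assms(1) by simp
  from sums_Re[OF this] show 2: "(\<lambda>k. c k * t ^ k) sums Re g" by simp
  from sums_unique2[OF sums_of_real[OF this] 1] show "of_real (Re g) = g" .
  show "0 \<le> Re g"
    using assms(2,3) sums_unique[OF 2] sums_summable[OF 2] by (simp add: suminf_nonneg)
qed

text \<open>Since \<open>mu t F\<close> is the image of a density with respect to counting measure,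
  integrals against it become absolutely convergent series.\<close>

lemma integral_mu:
  fixes g :: "real \<Rightarrow> 'b::{banach, second_countable_topology}"
  assumes [measurable]: "g \<in> borel_measurable borel"
    and p: "p = (\<lambda>k. taylor_coeff F k * t ^ k / Re (F (of_real t)))" "\<And>k. 0 \<le> p k"
    and sm: "summable (\<lambda>k. norm (p k *\<^sub>R g (real k)))"
  shows "integrable (mu t F) g" and "(\<lambda>k. p k *\<^sub>R g (real k)) sums (\<integral>x. g x \<partial>mu t F)"
proof -
  have mu_eq: "mu t F = distr (density (count_space UNIV) (\<lambda>k. ennreal (p k))) borel real"
    by (simp add: mu_def point_measure_def p(1))
  have m: "real \<in> measurable (density (count_space UNIV) (\<lambda>k. ennreal (p k))) borel"
    by simp
  have i: "integrable (count_space UNIV) (\<lambda>k. p k *\<^sub>R g (real k))"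
    using sm by (simp add: integrable_count_space_nat_iff)
  show "integrable (mu t F) g"
    using i p(2) unfolding mu_eq
    by (subst integrable_distr_eq[OF m]) (auto simp: integrable_density)
  have "(\<integral>x. g x \<partial>mu t F) = (\<integral>k. p k *\<^sub>R g (real k) \<partial>count_space UNIV)"
    unfolding mu_eq using p(2) m
    by (subst integral_distr) (auto simp: integral_density)
  then show "(\<lambda>k. p k *\<^sub>R g (real k)) sums (\<integral>x. g x \<partial>mu t F)"
    using sums_integral_count_space_nat[OF i] by simp
qed

lemma sum_in_Nats: "(\<And>i. i \<in> I \<Longrightarrow> g i \<in> \<nat>) \<Longrightarrow> sum g I \<in> \<nat>"
  for g :: "'i \<Rightarrow> real"
  by (induction I rule: infinite_finite_induct) auto

lemma AE_mu_Nats: "AE x in mu t F. x \<in> \<nat>"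
  unfolding mu_def by (subst AE_distr_iff) (auto simp: point_measure_def borel_closed)

context nonneg_prod
begin

lemma f_real:
  assumes "n \<ge> 1" "0 < t" "t < 1"
  shows sums_f_real: "(\<lambda>k. a k n * t ^ k) sums Re (f n (of_real t))"
    and f_of_real: "of_real (Re (f n (of_real t))) = f n (of_real t)"
    and f_real_pos: "0 < Re (f n (of_real t))"
proof -
  have s: "(\<lambda>k. of_real (a k n) * of_real t ^ k) sums f n (of_real t)"
    using assms by (intro sums_f) auto
  note r = nonneg_power_series_real[OF s coeff_nonneg[OF assms(1)]]
  show 1: "(\<lambda>k. a k n * t ^ k) sums Re (f n (of_real t))"
    and "of_real (Re (f n (of_real t))) = f n (of_real t)"
    using r assms by auto
  obtain k where "a k n \<noteq> 0" using coeff_nontrivial[OF assms(1)] by blast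
  then have "0 < a k n * t ^ k"
    using coeff_nonneg[OF assms(1), of k] assms(2) by simp
  then have "0 < (\<Sum>k. a k n * t ^ k)"
    using coeff_nonneg[OF assms(1)] assms(2) sums_summable[OF 1]
    by (intro suminf_pos2[of _ k]) auto
  then show "0 < Re (f n (of_real t))" using sums_unique[OF 1] by simp
qed

lemma inf_prod_real:
  assumes "0 < t" "t < 1"
  shows sums_inf_prod_real: "(\<lambda>k. prod_coeff a k * t ^ k) sums Re (inf_prod f (of_real t))"
    and inf_prod_of_real: "of_real (Re (inf_prod f (of_real t))) = inf_prod f (of_real t)"
    and inf_prod_pos: "0 < Re (inf_prod f (of_real t))"
proof -
  have t: "of_real t \<in> ball (0::complex) 1" using assms by simp
  note r = nonneg_power_series_real[OF sums_inf_prod[OF t] prod_coeff_nonneg]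
  show "(\<lambda>k. prod_coeff a k * t ^ k) sums Re (inf_prod f (of_real t))"
    and 1: "of_real (Re (inf_prod f (of_real t))) = inf_prod f (of_real t)"
    using r assms by auto
  \<comment> \<open>A convergent infinite product vanishes only if one of its factors does, and each
    factor is positive at \<open>t\<close>.\<close>
  have "f (Suc n) (of_real t) \<noteq> 0" for n
    using f_real_pos[of "Suc n" t] assms by auto
  then have "inf_prod f (of_real t) \<noteq> 0"
    unfolding inf_prod_def by (intro prodinf_nonzero convergent_prod_f t)
  moreover have "0 \<le> Re (inf_prod f (of_real t))"
    using r(3) assms by simp
  ultimately show "0 < Re (inf_prod f (of_real t))"
    using 1 by (metis less_eq_real_def of_real_0)
qed

text \<open>The mean is finite because the differentiated power series still converges at
  \<open>t < 1\<close>. The characteristic function arises by absorbing the phase into the variable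
  of the power series.\<close>

lemma mu_f:
  assumes n: "n \<ge> 1" and t: "0 < t" "t < 1"
  shows integrable_mu_f: "integrable (mu t (f n)) (\<lambda>x. x)"
    and char_mu_f: "char (mu t (f n)) x = f n (of_real t * iexp x) / f n (of_real t)"
proof -
  define R where "R = Re (f n (of_real t))"
  define p where "p = (\<lambda>k. taylor_coeff (f n) k * t ^ k / R)"
  have R: "0 < R" using f_real_pos[OF n t] by (simp add: R_def)
  have p: "0 \<le> p k" for k
    using R coeff_nonneg[OF n] t by (simp add: p_def taylor_coeff[OF n])
  note mu = integral_mu[OF _ p_def[unfolded R_def] p]
  have sm: "summable (\<lambda>k. a k n * y ^ k)" if "norm y < 1" for y :: real
  proof -
    have "summable (\<lambda>k. complex_of_real (a k n) * of_real y ^ k)"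
      using that by (intro sums_summable[OF sums_f[OF n]]) simp
    then have "summable (\<lambda>k. complex_of_real (a k n * y ^ k))" by simp
    then show ?thesis by (simp only: summable_complex_of_real)
  qed
  have "summable (\<lambda>k. diffs (\<lambda>k. a k n) k * t ^ k)"
    by (rule termdiff_converges[OF _ sm]) (use t in auto)
  \<comment> \<open>\<open>diffs\<close> shifts the index by one; the factor \<open>t / R\<close>
    restores the missing power of \<open>t\<close> and normalizes, giving the weight
    \<open>p (Suc k)\<close>.\<close>
  then have "summable (\<lambda>k. real (Suc k) * a (Suc k) n * t ^ k * (t / R))"
    by (intro summable_mult2) (simp add: diffs_def)
  then have "summable (\<lambda>k. p (Suc k) * real (Suc k))"
    by (simp add: p_def taylor_coeff[OF n] field_simps)
  then have "summable (\<lambda>k. norm (p k *\<^sub>R real k))"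
    using p by (subst summable_Suc_iff[symmetric]) (simp add: abs_mult)
  then show "integrable (mu t (f n)) (\<lambda>x. x)"
    by (intro mu) auto
  have "summable p"
    unfolding p_def taylor_coeff[OF n] by (intro summable_divide sm) (use t in simp)
  then have "summable (\<lambda>k. norm (p k *\<^sub>R iexp (x * real k)))"
    using p by simp
  then have "(\<lambda>k. p k *\<^sub>R iexp (x * real k)) sums char (mu t (f n)) x"
    unfolding char_def by (intro mu(2)[where g = "\<lambda>y. iexp (x * y)"]) auto
  moreover have "(\<lambda>k. of_real (a k n) * (of_real t * iexp x) ^ k / of_real R) sums
      (f n (of_real t * iexp x) / of_real R)"
    using n t by (intro sums_divide sums_f) (auto simp: norm_mult)
  moreover have "of_real (a k n) * (of_real t * iexp x) ^ k / of_real R = p k *\<^sub>R iexp (x * real k)" for k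
    by (simp add: p_def taylor_coeff[OF n] scaleR_conv_of_real power_mult_distrib
        exp_of_nat_mult[symmetric] mult_ac)
  ultimately have "char (mu t (f n)) x = f n (of_real t * iexp x) / of_real R"
    by (simp only: sums_unique2)
  then show "char (mu t (f n)) x = f n (of_real t * iexp x) / f n (of_real t)"
    unfolding R_def f_of_real[OF n t] .
qed

end

text \<open>One parameter \<open>t\<close> is held fixed here, with \<open>W\<close> and
  \<open>Y\<close> standing for \<open>M t\<close> and \<open>X t\<close>, so that the probabilistic
  facts are separated from the limit in \<open>t\<close>.\<close>

locale nonneg_prod_vars = nonneg_prod f a + prob_space W
  for f :: "nat \<Rightarrow> complex \<Rightarrow> complex" and a and W :: "'w measure" +
  fixes t :: real and Y :: "nat \<Rightarrow> 'w \<Rightarrow> real"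
  assumes t: "0 < t" "t < 1"
    and indep: "indep_vars (\<lambda>_. borel) Y {1..}"
    and law: "n \<ge> 1 \<Longrightarrow> distr W borel (Y n) = mu t (f n)"
    and summable_mean: "summable (\<lambda>n. expectation (Y (Suc n)))"
begin

lemma measurable_Y [measurable]: "Y (Suc n) \<in> borel_measurable W"
  using indep by (auto simp: indep_vars_def)

lemma integrable_Y: "integrable W (Y (Suc n))"
  using integrable_mu_f[of "Suc n" t] t
    integrable_distr_eq[OF measurable_Y[of n] measurable_ident_sets[OF refl]] law[of "Suc n"]
  by simp

lemma AE_Nats: "AE \<omega> in W. \<forall>n. Y (Suc n) \<omega> \<in> \<nat>"
proof (subst AE_all_countable, rule allI)
  fix n
  have "AE x in distr W borel (Y (Suc n)). x \<in> \<nat>"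
    by (subst law) (auto intro: AE_mu_Nats)
  then show "AE \<omega> in W. Y (Suc n) \<omega> \<in> \<nat>"
    by (subst (asm) AE_distr_iff) (auto simp: borel_closed)
qed

text \<open>The terms are almost surely nonnegative, so the expectation of the sum, taken in the
  extended reals, is the finite sum of the expectations. A sum with finite expectation is almost
  surely finite.\<close>

lemma AE_summable: "AE \<omega> in W. summable (\<lambda>n. Y (Suc n) \<omega>)"
proof -
  have nonneg: "AE \<omega> in W. \<forall>n. 0 \<le> Y (Suc n) \<omega>"
    using AE_Nats
  proof eventually_elim
    case (elim \<omega>)
    have "0 \<le> x" if "x \<in> \<nat>" for x :: real
      using that by (auto elim: Nats_cases)
    with elim show ?case by blast
  qed
  then have n1: "AE \<omega> in W. 0 \<le> Y (Suc n) \<omega>" for n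
    by eventually_elim auto
  have "(\<integral>\<^sup>+\<omega>. (\<Sum>n. ennreal (Y (Suc n) \<omega>)) \<partial>W) = (\<Sum>n. \<integral>\<^sup>+\<omega>. ennreal (Y (Suc n) \<omega>) \<partial>W)"
    by (intro nn_integral_suminf) auto
  also have "\<dots> = (\<Sum>n. ennreal (expectation (Y (Suc n))))"
    by (intro suminf_cong nn_integral_eq_integral integrable_Y n1)
  also have "\<dots> \<noteq> \<infinity>"
    using ennreal_suminf_neq_top[OF summable_mean integral_nonneg_AE[OF n1]] by simp
  finally have "AE \<omega> in W. (\<Sum>n. ennreal (Y (Suc n) \<omega>)) \<noteq> \<infinity>"
    by (intro nn_integral_noteq_infinite) auto
  with nonneg show ?thesis
  proof eventually_elim
    case (elim \<omega>)
    then show ?case by (intro summable_suminf_not_top) auto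
  qed
qed

text \<open>The terms of a convergent series are eventually below 1 in absolute value, and a natural
  number below 1 is 0. Hence almost surely the series is a finite sum of natural numbers.\<close>

lemma AE_total_Nats: "AE \<omega> in W. (\<Sum>n. Y (Suc n) \<omega>) \<in> \<nat>"
  using AE_Nats AE_summable
proof eventually_elim
  case (elim \<omega>)
  have "\<forall>\<^sub>F n in sequentially. norm (Y (Suc n) \<omega> - 0) < 1"
    using summable_LIMSEQ_zero[OF elim(2)] by (auto simp: tendsto_iff dist_norm)
  then obtain N where N: "\<And>n. n \<ge> N \<Longrightarrow> norm (Y (Suc n) \<omega>) < 1"
    by (auto simp: eventually_at_top_linorder)
  have "Y (Suc n) \<omega> = 0" if "n \<ge> N" for n
    using N[OF that] elim(1)[rule_format, of n] by (auto elim!: Nats_cases)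
  then have "(\<Sum>n. Y (Suc n) \<omega>) = (\<Sum>n<N. Y (Suc n) \<omega>)"
    by (intro suminf_finite) auto
  then show ?case using elim(1) by (auto intro!: sum_in_Nats)
qed

text \<open>Both sides are the limit of the characteristic functions of the partial sums: one by
  dominated convergence with bound 1, the other by independence and convergence of the product at
  \<open>t\<close> and at \<open>t\<close> times the phase.\<close>

lemma char_total:
  "(CLINT \<omega>|W. iexp (x * (\<Sum>n. Y (Suc n) \<omega>))) =
     inf_prod f (of_real t * iexp x) / inf_prod f (of_real t)"
proof (rule LIMSEQ_unique)
  let ?S = "\<lambda>N \<omega>. \<Sum>n=1..N. Y n \<omega>"
  have [measurable]: "?S N \<in> borel_measurable W" for N
  proof -
    have "?S N = (\<lambda>\<omega>. \<Sum>n<N. Y (Suc n) \<omega>)"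
      by (simp add: sum.atLeast1_atMost_eq lessThan_atLeast0)
    then show ?thesis by simp
  qed
  have [measurable]: "(\<lambda>\<omega>. iexp (x * ?S N \<omega>)) \<in> borel_measurable W" for N
    by measurable
  show "(\<lambda>N. CLINT \<omega>|W. iexp (x * ?S N \<omega>)) \<longlonglongrightarrow>
      (CLINT \<omega>|W. iexp (x * (\<Sum>n. Y (Suc n) \<omega>)))"
  proof (rule integral_dominated_convergence[where w = "\<lambda>_. 1"])
    show "AE \<omega> in W. (\<lambda>N. iexp (x * ?S N \<omega>)) \<longlonglongrightarrow> iexp (x * (\<Sum>n. Y (Suc n) \<omega>))"
      using AE_summable
    proof eventually_elim
      case (elim \<omega>)
      have "(\<lambda>N. ?S N \<omega>) \<longlonglongrightarrow> (\<Sum>n. Y (Suc n) \<omega>)"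
        using summable_LIMSEQ[OF elim] by (simp add: sum.atLeast1_atMost_eq lessThan_atLeast0)
      then show ?case by (intro tendsto_intros)
    qed
    show "AE \<omega> in W. norm (iexp (x * ?S N \<omega>)) \<le> 1" for N
      by (simp only: norm_exp_i_times) simp
  qed measurable
  have z: "of_real t * iexp x \<in> ball 0 1" "of_real t \<in> ball (0::complex) 1"
    using t by (auto simp: norm_mult)
  have "(CLINT \<omega>|W. iexp (x * ?S N \<omega>)) =
      (\<Prod>n=1..N. f n (of_real t * iexp x)) / (\<Prod>n=1..N. f n (of_real t))" for N
  proof -
    have "(CLINT \<omega>|W. iexp (x * ?S N \<omega>)) = char (distr W borel (?S N)) x"
      unfolding char_def by (rule integral_distr[symmetric]) measurable
    also have "\<dots> = (\<Prod>n=1..N. char (distr W borel (Y n)) x)"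
      by (rule char_distr_sum[where X = Y and A = "{1..N}", OF indep_vars_subset[OF indep]]) auto
    also have "\<dots> = (\<Prod>n=1..N. f n (of_real t * iexp x) / f n (of_real t))"
      using t by (intro prod.cong) (auto simp: law char_mu_f)
    finally show ?thesis by (simp add: prod_dividef)
  qed
  moreover have "inf_prod f (of_real t) \<noteq> 0" using inf_prod_pos[OF t] by auto
  ultimately show "(\<lambda>N. CLINT \<omega>|W. iexp (x * ?S N \<omega>)) \<longlonglongrightarrow>
      inf_prod f (of_real t * iexp x) / inf_prod f (of_real t)"
    using partial_prods_tendsto[OF z(1)] partial_prods_tendsto[OF z(2)]
    by (simp add: tendsto_divide)
qed

end

section \<open>Normal limits of lattice variables and Fourier inversion\<close>

text \<open>The density is everywhere positive, so a null interval for the normal law would also be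
  Lebesgue null.\<close>

lemma std_normal_interval_pos:
  assumes "x < y"
  shows "0 < measure std_normal_distribution {x<..y}"
proof -
  interpret real_distribution std_normal_distribution by (rule real_dist_normal_dist)
  have "emeasure std_normal_distribution {x<..y} \<noteq> 0"
  proof
    assume "emeasure std_normal_distribution {x<..y} = 0"
    then have "(\<integral>\<^sup>+z. ennreal (std_normal_density z) * indicator {x<..y} z \<partial>lborel) = 0"
      by (simp add: emeasure_density)
    then have "AE z in lborel. ennreal (std_normal_density z) * indicator {x<..y} z = 0"
      by (subst (asm) nn_integral_0_iff_AE) auto
    then have "AE z in lborel. z \<notin> {x<..y}"
      by eventually_elim
        (use order.strict_implies_not_eq[OF normal_density_pos[of 1 0]] in
          \<open>auto simp: indicator_def not_le split: if_splits\<close>)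
    then have "emeasure lborel {x<..y} = 0"
      by (subst (asm) AE_iff_measurable[of "{x<..y}"]) auto
    then show False using assms by simp
  qed
  then show ?thesis by (simp add: emeasure_eq_measure zero_less_measure_iff)
qed

lemma isCont_cdf_std_normal: "isCont (cdf std_normal_distribution) x"
proof -
  interpret real_distribution std_normal_distribution by (rule real_dist_normal_dist)
  have "emeasure std_normal_distribution {x} = 0"
    by (subst emeasure_density) (auto simp: nn_integral_0_iff_AE intro!: AE_I[of _ _ "{x}"] simp: indicator_def)
  then show ?thesis by (simp add: isCont_cdf measure_def)
qed

text \<open>
  Two disjoint intervals contained in a common interval shorter than the lattice spacing cannot both
  carry mass, while the normal law charges both.
\<close>

lemma weak_conv_normal_imp_lattice_scale_at_top:
  fixes W :: "'i \<Rightarrow> 'w measure" and S :: "'i \<Rightarrow> 'w \<Rightarrow> real" and m s :: "'i \<Rightarrow> real"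
  assumes conv: "weak_conv_filter (\<lambda>i. distr (W i) borel (\<lambda>\<omega>. (S i \<omega> - m i) / s i))
                   std_normal_distribution F"
    and lattice: "\<forall>\<^sub>F i in F. prob_space (W i) \<and> S i \<in> borel_measurable (W i) \<and>
                   (AE \<omega> in W i. S i \<omega> \<in> \<int>)"
  shows "filterlim (\<lambda>i. \<bar>s i\<bar>) at_top F"
proof (subst filterlim_at_top_gt[where c = 0], intro allI impI)
  fix Z :: real assume Z: "0 < Z"
  \<comment> \<open>The values of the normalized variable have spacing
    \<open>1 / \<bar>s i\<bar>\<close>, so the goal \<open>Z \<le> \<bar>s i\<bar>\<close> says that
    this spacing is at most \<open>h\<close>.\<close>
  define h where "h = 1 / Z"
  define L where "L = (\<lambda>i. distr (W i) borel (\<lambda>\<omega>. (S i \<omega> - m i) / s i))"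
  have h: "0 < h" using Z by (simp add: h_def)
  interpret N: real_distribution std_normal_distribution by (rule real_dist_normal_dist)
  have ev: "\<forall>\<^sub>F i in F. 0 < cdf (L i) y - cdf (L i) x" if "x < y" for x y
  proof -
    have "((\<lambda>i. cdf (L i) y - cdf (L i) x) \<longlongrightarrow>
        cdf std_normal_distribution y - cdf std_normal_distribution x) F"
      using conv isCont_cdf_std_normal
      by (intro tendsto_diff) (auto simp: weak_conv_filter_def L_def)
    moreover have "0 < cdf std_normal_distribution y - cdf std_normal_distribution x"
      using std_normal_interval_pos[OF that] N.cdf_diff_eq[OF that] by simp
    ultimately show ?thesis by (rule order_tendstoD)
  qed
  \<comment> \<open>The gap between the two quarter intervals makes the attained points distinct,
    and both lie within a range shorter than \<open>h\<close>.\<close>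
  have "\<forall>\<^sub>F i in F. 0 < cdf (L i) (h/4) - cdf (L i) 0"
    "\<forall>\<^sub>F i in F. 0 < cdf (L i) (3*h/4) - cdf (L i) (h/2)"
    using h by (intro ev; simp)+
  with lattice show "\<forall>\<^sub>F i in F. Z \<le> \<bar>s i\<bar>"
  proof eventually_elim
    case (elim i)
    then have meas [measurable]: "S i \<in> borel_measurable (W i)"
      and int: "AE \<omega> in W i. S i \<omega> \<in> \<int>" by auto
    interpret prob_space "W i" using elim by simp
    interpret L: real_distribution "L i"
      unfolding L_def by (rule real_distribution_distr) measurable
    have ex: "\<exists>\<omega>. S i \<omega> \<in> \<int> \<and> x < (S i \<omega> - m i) / s i \<and> (S i \<omega> - m i) / s i \<le> y"
      if "x < y" "0 < cdf (L i) y - cdf (L i) x" for x y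
    proof (rule ccontr)
      assume no: "\<not> ?thesis"
      from int have "AE \<omega> in W i. (S i \<omega> - m i) / s i \<notin> {x<..y}"
        by eventually_elim (use no in auto)
      then have "AE z in L i. z \<notin> {x<..y}"
        unfolding L_def by (subst AE_distr_iff) auto
      then have "emeasure (L i) {x<..y} = 0"
        by (subst (asm) AE_iff_measurable[of "{x<..y}"]) auto
      then have "measure (L i) {x<..y} = 0" by (simp add: measure_def)
      then show False using that L.cdf_diff_eq[OF that(1)] by simp
    qed
    obtain u where u: "S i u \<in> \<int>" "0 < (S i u - m i) / s i" "(S i u - m i) / s i \<le> h/4"
      using ex[of 0 "h/4"] elim h by auto
    obtain v where v: "S i v \<in> \<int>" "h/2 < (S i v - m i) / s i" "(S i v - m i) / s i \<le> 3*h/4"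
      using ex[of "h/2" "3*h/4"] elim h by auto
    \<comment> \<open>Division by 0 would give 0, which the strict lower bound at \<open>u\<close>
      excludes.\<close>
    have s: "s i \<noteq> 0" using u by auto
    have d: "(S i v - S i u) / s i = (S i v - m i) / s i - (S i u - m i) / s i"
      by (simp add: diff_divide_distrib)
    have d0: "0 < (S i v - S i u) / s i" and dh: "(S i v - S i u) / s i < h"
      using u v h unfolding d by linarith+
    have "1 \<le> \<bar>S i v - S i u\<bar>"
      using d0 u v by (intro Ints_nonzero_abs_ge1) auto
    also have "\<dots> = (S i v - S i u) / s i * \<bar>s i\<bar>"
      using d0 s by (metis abs_divide abs_of_pos abs_zero nonzero_eq_divide_eq abs_eq_0)
    also have "\<dots> \<le> h * \<bar>s i\<bar>"
      using dh by (intro mult_right_mono) auto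
    finally show ?case using Z by (simp add: h_def field_simps)
  qed
qed

text \<open>For nonzero \<open>j\<close> the antiderivative takes equal values at the two endpoints,
  because the exponents there differ by an integer multiple, namely \<open>j\<close>, of the period
  of the exponential.\<close>

lemma integral_iexp_period:
  fixes j :: int and s :: real
  assumes "0 < s"
  shows "(CLBINT x:{- s * pi..s * pi}. iexp (j * x / s)) = (if j = 0 then of_real (2 * pi * s) else 0)"
proof (cases "j = 0")
  case True
  then show ?thesis using assms by (simp add: set_lebesgue_integral_def scaleR_conv_of_real)
next
  case False
  define c where "c = \<i> * of_real (j / s)"
  have c: "c \<noteq> 0" using False assms by (simp add: c_def)
  have "(LBINT x:{- s * pi..s * pi}. exp (c * of_real x)) =
      exp (c * of_real (s * pi)) / c - exp (c * of_real (- s * pi)) / c"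
    unfolding set_lebesgue_integral_def
  proof (rule integral_FTC_atLeastAtMost)
    fix x
    show "((\<lambda>x. exp (c * of_real x) / c) has_vector_derivative exp (c * of_real x))
        (at x within {- s * pi..s * pi})"
      using c by (auto intro!: derivative_eq_intros has_vector_derivative_real_field)
  qed (use assms in \<open>auto intro!: continuous_intros mult_right_mono\<close>)
  also have "exp (c * of_real (s * pi)) = exp (c * of_real (- s * pi))"
    unfolding exp_eq using assms by (intro exI[of _ j]) (simp add: c_def field_simps)
  finally show ?thesis
    using False by (simp add: c_def mult_ac)
qed

text \<open>Absolute summability permits termwise integration, and orthogonality over the period
  leaves only the term \<open>k = n\<close>. The function \<open>g\<close> already contains the
  phase that moves this term to frequency 0.\<close>

lemma integral_Fourier_coefficient:
  fixes b :: "nat \<Rightarrow> real" and s :: real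
  assumes s: "0 < s" and b: "summable (\<lambda>k. norm (b k))"
    and g: "\<And>x. (\<lambda>k. of_real (b k) * iexp ((real k - real n) * x / s)) sums g x"
  shows "(CLBINT x:{- s * pi..s * pi}. g x) = of_real (2 * pi * s * b n)"
proof -
  let ?I = "{- s * pi..s * pi}"
  define u where "u = (\<lambda>k x. indicator ?I x *\<^sub>R (of_real (b k) * iexp ((real k - real n) * x / s)))"
  have ui: "integrable lborel (u k)" for k
    unfolding u_def
    by (intro borel_integrable_compact continuous_intros) (use s in auto)
  have n: "norm (u k x) = norm (b k) * indicator ?I x" for k x
    by (simp add: u_def norm_mult indicator_def)
  have "(\<integral>x. norm (u k x) \<partial>lborel) = norm (b k) * (2 * pi * s)" for k
    unfolding n using s by simp
  then have "summable (\<lambda>k. \<integral>x. norm (u k x) \<partial>lborel)"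
    using b by (simp add: summable_mult2)
  moreover have "AE x in lborel. summable (\<lambda>k. norm (u k x))"
    unfolding n using b by (intro AE_I2 summable_mult2)
  ultimately have "(\<lambda>k. \<integral>x. u k x \<partial>lborel) sums (\<integral>x. (\<Sum>k. u k x) \<partial>lborel)"
    by (intro sums_integral ui)
  moreover have "(\<Sum>k. u k x) = indicator ?I x *\<^sub>R g x" for x
    using sums_scaleR_right[OF g[of x], of "indicator ?I x"] by (simp add: u_def sums_iff)
  moreover have "(\<integral>x. u k x \<partial>lborel) = (if k = n then of_real (2 * pi * s * b n) else 0)" for k
  proof -
    have "(\<integral>x. u k x \<partial>lborel) = of_real (b k) * (CLBINT x:?I. iexp ((int k - int n) * x / s))"
      by (simp add: u_def set_lebesgue_integral_def flip: integral_mult_right_zero)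
    then show ?thesis
      unfolding integral_iexp_period[OF s] by (auto simp: mult_ac)
  qed
  ultimately have "(\<lambda>k. if k = n then of_real (2 * pi * s * b n) else 0) sums (CLBINT x:?I. g x)"
    by (simp add: set_lebesgue_integral_def)
  then show ?thesis
    using sums_single[of n "\<lambda>_. of_real (2 * pi * s * b n) :: complex"] by (metis (no_types, lifting) sums_cong sums_unique2)
qed

text \<open>Dominated convergence with the Gaussian itself as bound: at each fixed \<open>x\<close>
  the phase tends to 1 and the growing interval eventually contains \<open>x\<close>.\<close>

lemma integral_gaussian_iexp_tendsto:
  fixes s \<delta> :: "nat \<Rightarrow> real"
  assumes s: "filterlim s at_top sequentially" and \<delta>: "\<delta> \<longlonglongrightarrow> 0"
  shows "(\<lambda>n. CLBINT x:{- s n * pi..s n * pi}. of_real (exp (- x\<^sup>2 / 2)) * iexp (x * \<delta> n))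
           \<longlonglongrightarrow> of_real (sqrt (2 * pi))"
proof -
  have e: "exp (- x\<^sup>2 / 2) = sqrt (2 * pi) * std_normal_density x" for x :: real
    by (simp add: std_normal_density_def)
  have i: "integrable lborel (\<lambda>x::real. exp (- x\<^sup>2 / 2))"
    unfolding e using integrable_normal_density[of 1 0] by simp
  have v: "(LBINT x. exp (- x\<^sup>2 / 2)) = sqrt (2 * pi)"
    unfolding e using integral_normal_density[of 1 0] by simp
  have "(\<lambda>n. \<integral>x. indicator {- s n * pi..s n * pi} x *\<^sub>R (of_real (exp (- x\<^sup>2 / 2)) * iexp (x * \<delta> n)) \<partial>lborel)
      \<longlonglongrightarrow> (\<integral>x. complex_of_real (exp (- x\<^sup>2 / 2)) \<partial>lborel)"
  proof (rule integral_dominated_convergence[where w = "\<lambda>x. exp (- x\<^sup>2 / 2)"])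
    show "AE x in lborel. (\<lambda>n. indicator {- s n * pi..s n * pi} x *\<^sub>R (of_real (exp (- x\<^sup>2 / 2)) * iexp (x * \<delta> n)))
        \<longlonglongrightarrow> complex_of_real (exp (- x\<^sup>2 / 2))"
    proof (rule AE_I2)
      fix x :: real
      have "(\<lambda>n. of_real (exp (- x\<^sup>2 / 2)) * iexp (x * \<delta> n)) \<longlonglongrightarrow> of_real (exp (- x\<^sup>2 / 2)) * iexp (x * 0)"
        by (intro tendsto_intros \<delta>)
      moreover have "\<forall>\<^sub>F n in sequentially. \<bar>x\<bar> / pi \<le> s n"
        using s by (auto simp: filterlim_at_top)
      then have "\<forall>\<^sub>F n in sequentially. of_real (exp (- x\<^sup>2 / 2)) * iexp (x * \<delta> n) =
          indicator {- s n * pi..s n * pi} x *\<^sub>R (of_real (exp (- x\<^sup>2 / 2)) * iexp (x * \<delta> n))"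
        by eventually_elim (auto simp: indicator_def field_simps abs_le_iff)
      ultimately show "(\<lambda>n. indicator {- s n * pi..s n * pi} x *\<^sub>R (of_real (exp (- x\<^sup>2 / 2)) * iexp (x * \<delta> n)))
          \<longlonglongrightarrow> complex_of_real (exp (- x\<^sup>2 / 2))"
        by (auto intro: Lim_transform_eventually)
    qed
  qed (use i in \<open>auto simp: norm_mult indicator_def\<close>)
  then show ?thesis
    by (simp only: set_lebesgue_integral_def integral_complex_of_real v)
qed

section \<open>Normal approximation of the coefficients\<close>

context nonneg_prod_vars
begin

lemma char_normalized_total:
  "char (distr W borel (\<lambda>\<omega>. ((\<Sum>n. Y (Suc n) \<omega>) - m) / s)) x =
     iexp (- (m * x / s)) * (inf_prod f (of_real t * iexp (x / s)) / inf_prod f (of_real t))"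
proof -
  have "char (distr W borel (\<lambda>\<omega>. ((\<Sum>n. Y (Suc n) \<omega>) - m) / s)) x =
      (CLINT \<omega>|W. iexp (x * (((\<Sum>n. Y (Suc n) \<omega>) - m) / s)))"
    unfolding char_def by (rule integral_distr) measurable
  also have "\<dots> = (CLINT \<omega>|W. iexp (- (m * x / s)) * iexp (x / s * (\<Sum>n. Y (Suc n) \<omega>)))"
  proof (intro Bochner_Integration.integral_cong refl)
    fix \<omega>
    have "x * (((\<Sum>n. Y (Suc n) \<omega>) - m) / s) = - (m * x / s) + x / s * (\<Sum>n. Y (Suc n) \<omega>)"
      by (simp add: diff_divide_distrib algebra_simps)
    then show "iexp (x * (((\<Sum>n. Y (Suc n) \<omega>) - m) / s)) =
        iexp (- (m * x / s)) * iexp (x / s * (\<Sum>n. Y (Suc n) \<omega>))"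
      by (simp only: of_real_add distrib_left exp_add)
  qed
  finally show ?thesis by (simp only: integral_mult_right_zero char_total)
qed

text \<open>The centering phase of the characteristic function and the extra factor combine to the
  phase of frequency \<open>- n / s\<close>, with \<open>m\<close> cancelling. The integrand is then
  a shifted Fourier series whose term of frequency 0 is the normalized coefficient.\<close>

lemma prod_coeff_eq_integral_char:
  assumes s: "0 < s"
  shows "(CLBINT x:{- s * pi..s * pi}.
            char (distr W borel (\<lambda>\<omega>. ((\<Sum>n. Y (Suc n) \<omega>) - m) / s)) x * iexp (x * ((m - real n) / s))) =
         of_real (2 * pi * s * (prod_coeff a n * t ^ n / Re (inf_prod f (of_real t))))"
proof (rule integral_Fourier_coefficient[OF s])
  define R where "R = Re (inf_prod f (of_real t))"
  have R: "of_real R = inf_prod f (of_real t)" "0 < R"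
    using inf_prod_of_real[OF t] inf_prod_pos[OF t] by (simp_all add: R_def)
  have "summable (\<lambda>k. prod_coeff a k * t ^ k / R)"
    by (intro summable_divide sums_summable[OF sums_inf_prod_real[OF t]])
  then show "summable (\<lambda>k. norm (prod_coeff a k * t ^ k / Re (inf_prod f (of_real t))))"
    using R(2) t prod_coeff_nonneg by (simp add: R_def[symmetric])
  fix x :: real
  let ?z = "of_real t * iexp (x / s)"
  have "(\<lambda>k. iexp (- (real n * x / s)) * (of_real (prod_coeff a k) * ?z ^ k / of_real R)) sums
      (iexp (- (real n * x / s)) * (inf_prod f ?z / of_real R))"
    using t by (intro sums_mult sums_divide sums_inf_prod) (auto simp: norm_mult)
  moreover have "iexp (- (real n * x / s)) * (of_real (prod_coeff a k) * ?z ^ k / of_real R) =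
      of_real (prod_coeff a k * t ^ k / R) * iexp ((real k - real n) * x / s)" for k
  proof -
    have "iexp ((real k - real n) * x / s) = iexp (- (real n * x / s)) * iexp (x / s) ^ k"
      unfolding exp_of_nat_mult[symmetric] exp_add[symmetric]
      by (rule arg_cong[where f = exp]) (simp add: diff_divide_distrib algebra_simps)
    then show ?thesis by (simp add: power_mult_distrib)
  qed
  moreover have "iexp (- (m * x / s)) * (inf_prod f ?z / of_real R) * iexp (x * ((m - real n) / s)) =
      iexp (- (real n * x / s)) * (inf_prod f ?z / of_real R)"
  proof -
    have "iexp (- (real n * x / s)) = iexp (- (m * x / s)) * iexp (x * ((m - real n) / s))"
      unfolding exp_add[symmetric]
      by (rule arg_cong[where f = exp]) (simp add: diff_divide_distrib algebra_simps)
    then show ?thesis by simp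
  qed
  ultimately show "(\<lambda>k. of_real (prod_coeff a k * t ^ k / Re (inf_prod f (of_real t))) *
        iexp ((real k - real n) * x / s)) sums
      (char (distr W borel (\<lambda>\<omega>. ((\<Sum>n. Y (Suc n) \<omega>) - m) / s)) x * iexp (x * ((m - real n) / s)))"
    by (simp only: char_normalized_total R(1)[symmetric] Re_complex_of_real)
qed

text \<open>Multiplying by a phase of modulus 1 preserves norms, so replacing \<phi> by the Gaussian
  in the inversion integral costs at most their integrated distance. This is exactly the quantity
  that strong convergence controls.\<close>

lemma prod_coeff_normal_approx:
  fixes m s :: real
  assumes s: "0 < s"
  defines "\<phi> \<equiv> char (distr W borel (\<lambda>\<omega>. ((\<Sum>n. Y (Suc n) \<omega>) - m) / s))"
  shows "norm (of_real (2 * pi * s * (prod_coeff a n * t ^ n / Re (inf_prod f (of_real t)))) -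
           (CLBINT x:{- s * pi..s * pi}. of_real (exp (- x\<^sup>2 / 2)) * iexp (x * ((m - real n) / s))))
         \<le> (LBINT x:{- s * pi..s * pi}. norm (\<phi> x - of_real (exp (- x\<^sup>2 / 2))))"
proof -
  let ?I = "{- s * pi..s * pi}"
  let ?e = "\<lambda>x. iexp (x * ((m - real n) / s))"
  interpret L: real_distribution "distr W borel (\<lambda>\<omega>. ((\<Sum>n. Y (Suc n) \<omega>) - m) / s)"
    by (rule real_distribution_distr) measurable
  have cont: "continuous_on A \<phi>" for A
    unfolding \<phi>_def using L.isCont_char by (intro continuous_at_imp_continuous_on) auto
  have i: "set_integrable lborel ?I (\<lambda>x. \<phi> x * ?e x)"
    "set_integrable lborel ?I (\<lambda>x. of_real (exp (- x\<^sup>2 / 2)) * ?e x :: complex)"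
    by (intro borel_integrable_atLeastAtMost' continuous_intros cont; simp)+
  have e: "norm (\<phi> x * ?e x - of_real (exp (- x\<^sup>2 / 2)) * ?e x) = norm (\<phi> x - of_real (exp (- x\<^sup>2 / 2)))" for x
  proof -
    have "norm ((u - v) * ?e x) = norm (u - v)" for u v
      unfolding norm_mult norm_exp_i_times by (rule mult_1_right)
    then show ?thesis unfolding left_diff_distrib .
  qed
  have "of_real (2 * pi * s * (prod_coeff a n * t ^ n / Re (inf_prod f (of_real t)))) -
      (CLBINT x:?I. of_real (exp (- x\<^sup>2 / 2)) * ?e x) =
      (CLBINT x:?I. \<phi> x * ?e x - of_real (exp (- x\<^sup>2 / 2)) * ?e x)"
    unfolding set_integral_diff(2)[OF i]
    unfolding \<phi>_def prod_coeff_eq_integral_char[OF s] ..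
  then show ?thesis
    using set_integral_norm_bound[OF set_integral_diff(1)[OF i]] by (simp only: e)
qed

end

theorem theorem2p3:
  fixes f :: "nat \<Rightarrow> complex \<Rightarrow> complex"
    and a :: "nat \<Rightarrow> nat \<Rightarrow> real"
    and M :: "real \<Rightarrow> 'w measure"
    and X :: "real \<Rightarrow> nat \<Rightarrow> 'w \<Rightarrow> real"
    and m1 \<sigma>1 :: "real \<Rightarrow> real"
    and \<tau> :: "nat \<Rightarrow> real"
  assumes "\<And>n. n \<ge> 1 \<Longrightarrow> f n \<in> O_plus"
    and "\<And>n z. n \<ge> 1 \<Longrightarrow> z \<in> ball 0 1 \<Longrightarrow> (\<lambda>k. of_real (a k n) * z ^ k) sums f n z"
    and "compactly_convergent_prod f (ball 0 1)"
  shows "inf_prod f analytic_on ball 0 1 \<and>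
    (\<forall>n. family_term a summable_on families_with_sum n) \<and>
    (\<forall>z\<in>ball 0 1. (\<lambda>n. of_real (prod_coeff a n) * z ^ n) sums inf_prod f z) \<and>
    ((\<forall>t\<in>{0<..<1}. prob_space (M t) \<and>
        prob_space.indep_vars (M t) (\<lambda>_. borel) (X t) {1..} \<and>
        (\<forall>n\<ge>1. distr (M t) borel (X t n) = mu t (f n)) \<and>
        summable (\<lambda>n. mean_term M X t (Suc n)) \<and>
        summable (\<lambda>n. var_term M X t (Suc n))) \<longrightarrow>
     weak_conv_filter (Z_law M X) std_normal_distribution (at_left 1) \<longrightarrow>
     ((\<lambda>t. LBINT x:{- total_sd M X t * pi..total_sd M X t * pi}.
         norm (char (Z_law M X t) x - of_real (exp (- x\<^sup>2 / 2)))) \<longlongrightarrow> 0) (at_left 1) \<longrightarrow>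
     total_mean M X \<sim>[at_left 1] m1 \<longrightarrow>
     total_sd M X \<sim>[at_left 1] \<sigma>1 \<longrightarrow>
     (\<forall>n\<ge>1. \<tau> n \<in> {0<..<1} \<and> m1 (\<tau> n) = real n) \<longrightarrow>
     \<tau> \<longlonglongrightarrow> 1 \<longrightarrow>
     (\<lambda>n. (total_mean M X (\<tau> n) - m1 (\<tau> n)) / \<sigma>1 (\<tau> n)) \<longlonglongrightarrow> 0 \<longrightarrow>
     prod_coeff a \<sim>[sequentially]
       (\<lambda>n. Re (inf_prod f (of_real (\<tau> n))) / (sqrt (2 * pi) * \<sigma>1 (\<tau> n) * \<tau> n ^ n)))"
proof (intro conjI impI)
  interpret nonneg_prod f a by standard (fact assms)+
  show "inf_prod f analytic_on ball 0 1"
    using inf_prod_holomorphic by (simp add: analytic_on_open)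
  show "\<forall>n. family_term a summable_on families_with_sum n"
    using family_term_has_sum summable_on_def by blast
  show "\<forall>z\<in>ball 0 1. (\<lambda>n. of_real (prod_coeff a n) * z ^ n) sums inf_prod f z"
    using sums_inf_prod by blast

  \<comment> \<open>Asymptotics of the coefficients\<close>
  assume vars: "\<forall>t\<in>{0<..<1}. prob_space (M t) \<and>
        prob_space.indep_vars (M t) (\<lambda>_. borel) (X t) {1..} \<and>
        (\<forall>n\<ge>1. distr (M t) borel (X t n) = mu t (f n)) \<and>
        summable (\<lambda>n. mean_term M X t (Suc n)) \<and>
        summable (\<lambda>n. var_term M X t (Suc n))"
    and weak: "weak_conv_filter (Z_law M X) std_normal_distribution (at_left 1)"
    and strong: "((\<lambda>t. LBINT x:{- total_sd M X t * pi..total_sd M X t * pi}.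
         norm (char (Z_law M X t) x - of_real (exp (- x\<^sup>2 / 2)))) \<longlongrightarrow> 0) (at_left 1)"
    and sd: "total_sd M X \<sim>[at_left 1] \<sigma>1"
    and \<tau>: "\<forall>n\<ge>1. \<tau> n \<in> {0<..<1} \<and> m1 (\<tau> n) = real n" "\<tau> \<longlonglongrightarrow> 1"
    and mean: "(\<lambda>n. (total_mean M X (\<tau> n) - m1 (\<tau> n)) / \<sigma>1 (\<tau> n)) \<longlonglongrightarrow> 0"
  have loc: "nonneg_prod_vars f a (M t) t (X t)" if "t \<in> {0<..<1}" for t
    using vars that
    by (intro nonneg_prod_vars.intro nonneg_prod_vars_axioms.intro nonneg_prod_axioms)
       (auto simp: mean_term_def)
  have Z_law_eq: "Z_law M X = (\<lambda>t. distr (M t) borel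
      (\<lambda>\<omega>. ((\<Sum>n. X t (Suc n) \<omega>) - total_mean M X t) / total_sd M X t))"
    by (simp add: Z_law_def[abs_def] Z_var_def[abs_def] total_def[abs_def])
  have unit_ev: "\<forall>\<^sub>F t in at_left 1. t \<in> {0<..<1::real}"
    by (rule eventually_at_left_real) simp
  have sd_nonneg: "0 \<le> total_sd M X t" if "t \<in> {0<..<1}" for t
    unfolding total_sd_def using vars that
    by (intro real_sqrt_ge_zero suminf_nonneg) (auto simp: var_term_def)

  \<comment> \<open>The sum is almost surely an integer, so its scale must blow up for a normal
    limit to be possible.\<close>
  have "filterlim (\<lambda>t. \<bar>total_sd M X t\<bar>) at_top (at_left 1)"
  proof (rule weak_conv_normal_imp_lattice_scale_at_top[OF weak[unfolded Z_law_eq]])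
    show "\<forall>\<^sub>F t in at_left 1. prob_space (M t) \<and>
        (\<lambda>\<omega>. \<Sum>n. X t (Suc n) \<omega>) \<in> borel_measurable (M t) \<and>
        (AE \<omega> in M t. (\<Sum>n. X t (Suc n) \<omega>) \<in> \<int>)"
      using unit_ev
    proof eventually_elim
      case (elim t)
      interpret nonneg_prod_vars f a "M t" t "X t" by (rule loc[OF elim])
      have "AE \<omega> in M t. (\<Sum>n. X t (Suc n) \<omega>) \<in> \<int>"
        using AE_total_Nats Nats_subset_Ints by (auto elim: eventually_mono)
      then show ?case by (simp add: prob_space_axioms)
    qed
  qed
  moreover have "\<forall>\<^sub>F t in at_left 1. \<bar>total_sd M X t\<bar> = total_sd M X t"
    using unit_ev by eventually_elim (simp add: sd_nonneg)
  ultimately have sd_top: "filterlim (total_sd M X) at_top (at_left 1)"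
    by (simp cong: filterlim_cong)

  \<comment> \<open>The value of \<tau> at 0 is unconstrained, hence the eventual form. Staying
    below 1 upgrades convergence to 1 to convergence along \<open>at_left 1\<close>.\<close>
  have \<tau>_unit: "\<forall>\<^sub>F n in sequentially. \<tau> n \<in> {0<..<1} \<and> m1 (\<tau> n) = real n"
    using eventually_ge_at_top[of 1] by eventually_elim (use \<tau>(1) in blast)
  then have \<tau>_lim: "filterlim \<tau> (at_left 1) sequentially"
    by (intro tendsto_imp_filterlim_at_left \<tau>(2)) (auto elim: eventually_mono)
  define s where "s = (\<lambda>n. total_sd M X (\<tau> n))"
  \<comment> \<open>This is the frequency left in the inversion integral. The hypothesis bounds it
    with \<open>m1\<close> and \<open>\<sigma>1\<close> instead;
    \<open>m1 (\<tau> n) = real n\<close> and the equivalence of \<open>s\<close> with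
    \<open>\<sigma>1\<close> along the sequence allow the transfer.\<close>
  define \<delta> where "\<delta> = (\<lambda>n. (total_mean M X (\<tau> n) - real n) / s n)"
  have s_top: "filterlim s at_top sequentially"
    unfolding s_def by (rule filterlim_compose[OF sd_top \<tau>_lim])
  then have s_pos: "\<forall>\<^sub>F n in sequentially. 0 < s n"
    by (rule eventually_compose_filterlim[OF eventually_gt_at_top])
  have s_equiv: "s \<sim>[sequentially] (\<lambda>n. \<sigma>1 (\<tau> n))"
    unfolding s_def by (rule asymp_equiv_compose'[OF sd \<tau>_lim])
  have \<delta>: "\<delta> \<longlonglongrightarrow> 0"
  proof (rule tendsto_asymp_equiv_cong[THEN iffD2])
    show "\<delta> \<sim>[sequentially] (\<lambda>n. (total_mean M X (\<tau> n) - real n) / \<sigma>1 (\<tau> n))"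
      unfolding \<delta>_def by (intro asymp_equiv_intros s_equiv)
    have "\<forall>\<^sub>F n in sequentially. (total_mean M X (\<tau> n) - m1 (\<tau> n)) / \<sigma>1 (\<tau> n) =
        (total_mean M X (\<tau> n) - real n) / \<sigma>1 (\<tau> n)"
      using \<tau>_unit by eventually_elim simp
    then show "(\<lambda>n. (total_mean M X (\<tau> n) - real n) / \<sigma>1 (\<tau> n)) \<longlonglongrightarrow> 0"
      by (rule Lim_transform_eventually[OF mean])
  qed

  define R where "R = (\<lambda>n. Re (inf_prod f (of_real (\<tau> n))))"
  \<comment> \<open>\<open>c\<close> is the value of the inversion integral, \<open>G\<close> its
    Gaussian counterpart and \<open>D\<close> the bound for their distance.\<close>
  define c where "c = (\<lambda>n. 2 * pi * s n * (prod_coeff a n * \<tau> n ^ n / R n))"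
  define G where "G = (\<lambda>n. CLBINT x:{- s n * pi..s n * pi}. of_real (exp (- x\<^sup>2 / 2)) * iexp (x * \<delta> n))"
  define D where "D = (\<lambda>n. LBINT x:{- s n * pi..s n * pi}.
         norm (char (Z_law M X (\<tau> n)) x - of_real (exp (- x\<^sup>2 / 2))))"
  have "D \<longlonglongrightarrow> 0"
    unfolding D_def s_def by (rule filterlim_compose[OF strong \<tau>_lim])
  moreover have "\<forall>\<^sub>F n in sequentially. norm (of_real (c n) - G n) \<le> D n"
    using \<tau>_unit s_pos
  proof eventually_elim
    case (elim n)
    then interpret nonneg_prod_vars f a "M (\<tau> n)" "\<tau> n" "X (\<tau> n)" by (intro loc) auto
    show ?case
      using prod_coeff_normal_approx[OF elim(2), of n "total_mean M X (\<tau> n)"]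
      by (simp only: c_def G_def D_def R_def \<delta>_def fun_cong[OF Z_law_eq] s_def)
  qed
  ultimately have "(\<lambda>n. of_real (c n) - G n) \<longlonglongrightarrow> 0"
    by (rule Lim_null_comparison[rotated])
  from tendsto_add[OF this integral_gaussian_iexp_tendsto[OF s_top \<delta>, folded G_def]]
  have "(\<lambda>n. complex_of_real (c n)) \<longlonglongrightarrow> of_real (sqrt (2 * pi))"
    by simp
  then have c: "c \<longlonglongrightarrow> sqrt (2 * pi)"
    by (simp only: tendsto_of_real_iff)

  have "prod_coeff a \<sim>[sequentially] (\<lambda>n. R n / (sqrt (2 * pi) * s n * \<tau> n ^ n))"
  proof (rule asymp_equivI')
    \<comment> \<open>Dividing \<open>c n\<close> by its limit yields exactly the quotient of the
      coefficient by its claimed equivalent, still with \<open>s\<close> in place of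
      \<open>\<sigma>1\<close>.\<close>
    have "(\<lambda>n. c n / sqrt (2 * pi)) \<longlonglongrightarrow> sqrt (2 * pi) / sqrt (2 * pi)"
      by (intro tendsto_divide c tendsto_const) simp
    then have "(\<lambda>n. c n / sqrt (2 * pi)) \<longlonglongrightarrow> 1" by simp
    moreover have "c n / sqrt (2 * pi) = prod_coeff a n / (R n / (sqrt (2 * pi) * s n * \<tau> n ^ n))" for n
    proof -
      have "2 * pi / sqrt (2 * pi) = sqrt (2 * pi)" by (simp add: real_div_sqrt)
      then have "c n / sqrt (2 * pi) = sqrt (2 * pi) * s n * (prod_coeff a n * \<tau> n ^ n / R n)"
        unfolding c_def by (metis (no_types, opaque_lifting) times_divide_eq_left)
      then show ?thesis by (simp add: mult_ac)
    qed
    ultimately show "(\<lambda>n. prod_coeff a n / (R n / (sqrt (2 * pi) * s n * \<tau> n ^ n))) \<longlonglongrightarrow> 1"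
      by simp
  qed
  also have "\<dots> \<sim>[sequentially] (\<lambda>n. R n / (sqrt (2 * pi) * \<sigma>1 (\<tau> n) * \<tau> n ^ n))"
    by (intro asymp_equiv_intros s_equiv)
  finally show "prod_coeff a \<sim>[sequentially]
      (\<lambda>n. Re (inf_prod f (of_real (\<tau> n))) / (sqrt (2 * pi) * \<sigma>1 (\<tau> n) * \<tau> n ^ n))"
    by (simp add: R_def)
qed

end
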